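(* Let $N$ be a positive integer, let $\nu$ be a finite Borel measure essentially supported on a fundamental domain $D$ of a closed subgroup $G$ of $\mathbb{R}^d$, and let $\mu=\mu_1+\cdots+\mu_N$ be a multi-tiling measure with respect to $G$ built from $\nu$, with associated functions $g_1,\ldots,g_N$ and determinant function $\mathfrak{D}_x$. Suppose that there exist $\epsilon_0>0$ and $t_1,\ldots,t_N\in\mathbb{R}^d$ such that, with $\mathbf{t}=(t_1,\ldots,t_N)$, $|\mathfrak{D}_x(\mathbf{t})|\ge\epsilon_0$ for $\nu$-a.e. $x$. Then there exists $m>0$ such that $\min_{j\ne k}|g_j(x)-g_k(x)|\ge m$ for $\nu$-a.e. $x$.
   Context: $G$ is a closed additive subgroup of $\mathbb{R}^d$, not necessarily discrete. A fundamental domain of $G$ is a Borel subset of $\mathbb{R}^d$ containing exactly one representative of each coset in $\mathbb{R}^d/G$. Multi-tiling measures. An essential support of a finite Borel measure $\rho$ is a Borel set $X_\rho$ with $\rho(X_\rho)=\rho(\mathbb{R}^d)$, denoted $\mathrm{supp}(\rho)$. Let $\nu$ be a finite Borel measure with essential support contained in $D$. Let $\mu_1,\ldots,\mu_N$ be finite Borel measures such that each $\mu_k$ has an essential support $X_k$ contained in some fundamental domain $D_k$ of $G$. Let $\pi_k:X_k\to D$ be the injective map sending $y$ to the unique element of $D\cap(y+G)$, and assume $\mu_k=\nu\circ\pi_k$, i.e. $\mu_k(B)=\nu(\pi_k(B\cap X_k))$ for every Borel set $B$. Assume $\mathrm{supp}(\nu)\subset\pi_k(X_k)$, so that for each $x\in\mathrm{supp}(\nu)$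 and each $j$ there is a unique $g_j(x)\in G$ with $x+g_j(x)\in X_j$. If moreover $\mu=\mu_1+\cdots+\mu_N$ satisfies $\mu(X_j\cap X_k)=0$ for all $j\ne k$, then $\mu$ is called the multi-tiling measure of $\mu_1,\ldots,\mu_N$ with respect to $G$. For $\mathbf{t}=(t_1,\ldots,t_N)$ with $t_k\in\mathbb{R}^d$ and $x\in\mathrm{supp}(\nu)$, $M_x(\mathbf{t})$ is the $N\times N$ matrix with entries $(M_x(\mathbf{t}))_{j,k}=e^{2\pi i t_k\cdot g_j(x)}$, and $\mathfrak{D}_x(\mathbf{t})=\det M_x(\mathbf{t})$. $|\cdot|$ is the Euclidean norm on $\mathbb{R}^d$; for $N=1$ the minimum over the empty set is $+\infty$. *)

theory Defs
  imports "HOL-Analysis.Analysis"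
begin

definition closed_additive_subgroup :: "(real ^ 'd) set \<Rightarrow> bool" where
  "closed_additive_subgroup G \<longleftrightarrow>
     closed G \<and> 0 \<in> G \<and> (\<forall>x\<in>G. \<forall>y\<in>G. x + y \<in> G) \<and> (\<forall>x\<in>G. - x \<in> G)"

definition coset_of :: "(real ^ 'd) set \<Rightarrow> real ^ 'd \<Rightarrow> (real ^ 'd) set" where
  "coset_of G y = (\<lambda>h. y + h) ` G"

definition fundamental_domain :: "(real ^ 'd) set \<Rightarrow> (real ^ 'd) set \<Rightarrow> bool" where
  "fundamental_domain G D \<longleftrightarrow> D \<in> sets borel \<and> (\<forall>y. \<exists>!x. x \<in> D \<inter> coset_of G y)"

definition finite_borel_measure :: "(real ^ 'd) measure \<Rightarrow> bool" where
  "finite_borel_measure \<rho> \<longleftrightarrow> finite_measure \<rho> \<and> sets \<rho> = sets borel"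

definition essential_support :: "(real ^ 'd) measure \<Rightarrow> (real ^ 'd) set \<Rightarrow> bool" where
  "essential_support \<rho> X \<longleftrightarrow> X \<in> sets borel \<and> emeasure \<rho> X = emeasure \<rho> UNIV"

text \<open>The map \<open>\<pi>\<^sub>k\<close> is the restriction of the following function to \<open>X\<^sub>k\<close>.\<close>

definition domain_rep :: "(real ^ 'd) set \<Rightarrow> (real ^ 'd) set \<Rightarrow> real ^ 'd \<Rightarrow> real ^ 'd" where
  "domain_rep G D y = (THE x. x \<in> D \<inter> coset_of G y)"

text \<open>The element \<open>g\<^sub>j(x)\<close> is \<open>shift G (X j) x\<close>. It is meaningful only for \<open>x\<close> in the
  essential support of \<open>\<nu>\<close>; the values elsewhere concern a \<open>\<nu>\<close>-null set.\<close>

definition shift :: "(real ^ 'd) set \<Rightarrow> (real ^ 'd) set \<Rightarrow> real ^ 'd \<Rightarrow> real ^ 'd" where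
  "shift G Y x = (THE g. g \<in> G \<and> x + g \<in> Y)"

text \<open>The indices \<open>1, \<dots>, N\<close> are the elements of a finite type \<open>'n\<close>, so \<open>N = CARD('n) \<ge> 1\<close>.
  The set \<open>S\<close> is the essential support \<open>supp(\<nu>)\<close>. The images in \<open>tiling\<close> are
  Borel by the Lusin-Souslin theorem: \<open>\<pi>\<^sub>k\<close> is injective with a Borel graph, as \<open>G\<close> is closed.\<close>

locale multi_tiling =
  fixes G :: "(real ^ 'd) set"
    and D :: "(real ^ 'd) set"
    and \<nu> :: "(real ^ 'd) measure"
    and S :: "(real ^ 'd) set"
    and Dk :: "'n::finite \<Rightarrow> (real ^ 'd) set"
    and X :: "'n \<Rightarrow> (real ^ 'd) set"
    and \<mu>k :: "'n \<Rightarrow> (real ^ 'd) measure"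
    and \<mu> :: "(real ^ 'd) measure"
  assumes subgroup: "closed_additive_subgroup G"
    and domain: "fundamental_domain G D"
    and nu: "finite_borel_measure \<nu>"
    and nu_support: "essential_support \<nu> S" "S \<subseteq> D"
    and domains: "\<And>k. fundamental_domain G (Dk k)"
    and mu_k: "\<And>k. finite_borel_measure (\<mu>k k)"
    and mu_k_support: "\<And>k. essential_support (\<mu>k k) (X k)" "\<And>k. X k \<subseteq> Dk k"
    and tiling: "\<And>k B. B \<in> sets borel \<Longrightarrow>
                   emeasure (\<mu>k k) B = emeasure \<nu> (domain_rep G D ` (B \<inter> X k))"
    and covering: "\<And>k. S \<subseteq> domain_rep G D ` X k"
    and mu_sets: "sets \<mu> = sets borel"
    and mu_sum: "\<And>B. B \<in> sets borel \<Longrightarrow> emeasure \<mu> B = (\<Sum>k\<in>UNIV. emeasure (\<mu>k k) B)"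
    and disjoint: "\<And>j k. j \<noteq> k \<Longrightarrow> emeasure \<mu> (X j \<inter> X k) = 0"
begin

lemma ex1_domain_rep: "\<exists>!x. x \<in> D \<inter> coset_of G y"
  using domain by (simp add: fundamental_domain_def)

lemma ex1_shift:
  assumes "x \<in> S"
  shows "\<exists>!g. g \<in> G \<and> x + g \<in> X k"
proof -
  from assms covering obtain y where y: "y \<in> X k" "x = domain_rep G D y"
    by blast
  have "x \<in> D \<inter> coset_of G y"
    unfolding y(2) domain_rep_def by (rule theI'[OF ex1_domain_rep])
  then obtain h where h: "h \<in> G" "x = y + h"
    by (auto simp: coset_of_def)
  show ?thesis
  proof (rule ex1I)
    show "- h \<in> G \<and> x + - h \<in> X k"
      using h y subgroup by (simp add: closed_additive_subgroup_def)
  next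
    fix g assume g: "g \<in> G \<and> x + g \<in> X k"
    have "h + g \<in> G" "0 \<in> G"
      using g h subgroup by (auto simp: closed_additive_subgroup_def)
    then have "x + g \<in> Dk k \<inter> coset_of G y" "y \<in> Dk k \<inter> coset_of G y"
      using g h y(1) mu_k_support(2)[of k]
      by (auto simp: coset_of_def image_iff add.assoc intro: bexI[of _ 0])
    then have "x + g = y"
      using domains[of k] unfolding fundamental_domain_def by blast
    then show "g = - h"
      using h by (simp add: add.assoc eq_neg_iff_add_eq_0 add.commute)
  qed
qed

end

definition tiling_matrix ::
  "(real ^ 'd) set \<Rightarrow> ('n::finite \<Rightarrow> (real ^ 'd) set) \<Rightarrow> ('n \<Rightarrow> real ^ 'd) \<Rightarrow> real ^ 'd \<Rightarrow> complex ^ 'n ^ 'n"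
  where
  "tiling_matrix G X t x =
     (\<chi> j k. exp (2 * of_real pi * \<i> * of_real (t k \<bullet> shift G (X j) x)))"

definition tiling_det ::
  "(real ^ 'd) set \<Rightarrow> ('n::finite \<Rightarrow> (real ^ 'd) set) \<Rightarrow> ('n \<Rightarrow> real ^ 'd) \<Rightarrow> real ^ 'd \<Rightarrow> complex"
  where
  "tiling_det G X t x = det (tiling_matrix G X t x)"

text \<open>For \<open>N = 1\<close> the infimum is over the empty set and equals \<open>\<infinity>\<close>; otherwise it is a
  minimum over a finite set.\<close>

definition min_separation ::
  "(real ^ 'd) set \<Rightarrow> ('n::finite \<Rightarrow> (real ^ 'd) set) \<Rightarrow> real ^ 'd \<Rightarrow> ereal"
  where
  "min_separation G X x =
     (INF (j, k) \<in> {(j, k). j \<noteq> k}. ereal (norm (shift G (X j) x - shift G (X k) x)))"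

end

theory Submission
  imports Defs
begin

text \<open>If two of the shifts \<open>g\<^sub>j(x)\<close>, \<open>g\<^sub>k(x)\<close> are close, then two rows of the matrix
  \<open>M\<^sub>x(t)\<close> nearly agree, so its determinant is nearly zero. Quantitatively, subtracting row \<open>k\<close>
  from row \<open>j\<close> leaves the determinant unchanged, and since \<open>s \<mapsto> exp (i s)\<close> is \<open>1\<close>-Lipschitz the
  new row has entries of size at most \<open>2 \<pi> T \<bar>g\<^sub>j(x) - g\<^sub>k(x)\<bar>\<close>, where \<open>T\<close> bounds all the
  \<open>\<bar>t\<^sub>k\<bar>\<close>. All other entries have modulus one, so the Leibniz expansion gives
  \<open>\<bar>det M\<^sub>x(t)\<bar> \<le> N! \<cdot> 2 \<pi> T \<bar>g\<^sub>j(x) - g\<^sub>k(x)\<bar>\<close> (\<open>norm_tiling_det_le\<close>). A lower bound on the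
  determinant is therefore a lower bound on the separation. This happens at each point \<open>x\<close>
  separately, so the exceptional null set does not change.\<close>

lemma norm_exp_imaginary_diff_le:
  "norm (exp (\<i> * of_real a) - exp (\<i> * of_real b)) \<le> \<bar>a - b\<bar>"
proof -
  have "exp (\<i> * of_real a) - exp (\<i> * of_real b)
      = exp (\<i> * of_real b) * (exp (\<i> * of_real (a - b)) - 1)"
    by (simp add: algebra_simps flip: exp_add)
  also have "norm \<dots> = 2 * \<bar>sin ((a - b) / 2)\<bar>"
    using dist_exp_i_1[of "a - b"] by (simp add: norm_mult dist_norm)
  also have "\<dots> \<le> \<bar>a - b\<bar>"
    using abs_sin_x_le_abs_x[of "(a - b) / 2"] by simp
  finally show ?thesis .
qed

text \<open>Each of the \<open>N!\<close> products in the Leibniz expansion contains exactly one entry of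
  row \<open>j\<close>.\<close>

lemma norm_det_le_small_row:
  fixes A :: "complex ^ 'n::finite ^ 'n"
  assumes row: "\<And>l. norm (A $ j $ l) \<le> \<delta>"
    and others: "\<And>i l. i \<noteq> j \<Longrightarrow> norm (A $ i $ l) \<le> 1"
  shows "norm (det A) \<le> fact CARD('n) * \<delta>"
proof -
  have term_le: "norm (of_int (sign p) * (\<Prod>i\<in>UNIV. A $ i $ p i)) \<le> \<delta>" for p
  proof -
    have "norm (of_int (sign p) * (\<Prod>i\<in>UNIV. A $ i $ p i)) = (\<Prod>i\<in>UNIV. norm (A $ i $ p i))"
      by (simp add: norm_mult sign_def prod_norm)
    also have "\<dots> = norm (A $ j $ p j) * (\<Prod>i\<in>UNIV - {j}. norm (A $ i $ p i))"
      by (simp add: prod.remove)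
    also have "\<dots> \<le> norm (A $ j $ p j) * 1"
      by (intro mult_left_mono prod_le_1) (use others in auto)
    finally show ?thesis
      using row[of "p j"] by linarith
  qed
  have "norm (det A) \<le> real (card {p. p permutes (UNIV :: 'n set)}) * \<delta>"
    unfolding det_def by (rule sum_norm_bound) (rule term_le)
  also have "card {p. p permutes (UNIV :: 'n set)} = fact CARD('n)"
    by (rule card_permutations) auto
  finally show ?thesis by simp
qed

lemma norm_det_le_row_diff:
  fixes A :: "complex ^ 'n::finite ^ 'n"
  assumes "j \<noteq> k"
    and row: "\<And>l. norm (A $ j $ l - A $ k $ l) \<le> \<delta>"
    and entries: "\<And>i l. norm (A $ i $ l) \<le> 1"
  shows "norm (det A) \<le> fact CARD('n) * \<delta>"
proof -
  define B where "B = (\<chi> i. if i = j then row j A + (- 1) *s row k A else row i A)"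
  have "det A = det B"
    unfolding B_def using det_row_operation[OF \<open>j \<noteq> k\<close>, of A "- 1"] by simp
  also have "norm (det B) \<le> fact CARD('n) * \<delta>"
    by (rule norm_det_le_small_row[where j = j])
      (use row entries in \<open>simp_all add: B_def row_def\<close>)
  finally show ?thesis .
qed

lemma norm_tiling_det_le:
  fixes X :: "'n::finite \<Rightarrow> (real ^ 'd) set"
  assumes "j \<noteq> k" and T: "\<And>l. norm (t l) \<le> T"
  shows "norm (tiling_det G X t x)
           \<le> fact CARD('n) * (2 * pi * T * norm (shift G (X j) x - shift G (X k) x))"
  unfolding tiling_det_def
proof (rule norm_det_le_row_diff[OF \<open>j \<noteq> k\<close>])
  let ?g = "\<lambda>i. shift G (X i) x"
  have entry: "tiling_matrix G X t x $ i $ l = exp (\<i> * of_real (2 * pi * (t l \<bullet> ?g i)))" for i l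
    by (simp add: tiling_matrix_def mult_ac)
  show "norm (tiling_matrix G X t x $ i $ l) \<le> 1" for i l
    unfolding entry by (simp only: norm_exp_i_times)
  show "norm (tiling_matrix G X t x $ j $ l - tiling_matrix G X t x $ k $ l)
          \<le> 2 * pi * T * norm (?g j - ?g k)" for l
  proof -
    have "norm (tiling_matrix G X t x $ j $ l - tiling_matrix G X t x $ k $ l)
        \<le> \<bar>2 * pi * (t l \<bullet> ?g j) - 2 * pi * (t l \<bullet> ?g k)\<bar>"
      unfolding entry by (rule norm_exp_imaginary_diff_le)
    also have "\<dots> = 2 * pi * \<bar>t l \<bullet> (?g j - ?g k)\<bar>"
      by (simp add: inner_diff_right abs_mult flip: right_diff_distrib)
    also have "\<dots> \<le> 2 * pi * (norm (t l) * norm (?g j - ?g k))"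
      by (intro mult_left_mono Cauchy_Schwarz_ineq2) simp
    also have "\<dots> \<le> 2 * pi * (T * norm (?g j - ?g k))"
      by (intro mult_left_mono mult_right_mono T) simp_all
    finally show ?thesis by (simp add: mult_ac)
  qed
qed

theorem theorem4p2:
  fixes G D S :: "(real ^ 'd) set"
    and \<nu> \<mu> :: "(real ^ 'd) measure"
    and Dk X :: "'n::finite \<Rightarrow> (real ^ 'd) set"
    and \<mu>k :: "'n \<Rightarrow> (real ^ 'd) measure"
  assumes "multi_tiling G D \<nu> S Dk X \<mu>k \<mu>"
    and "\<exists>\<epsilon>0>0. \<exists>t :: 'n \<Rightarrow> real ^ 'd. AE x in \<nu>. \<epsilon>0 \<le> norm (tiling_det G X t x)"
  shows "\<exists>m::real. m > 0 \<and> (AE x in \<nu>. ereal m \<le> min_separation G X x)"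
proof -
  obtain \<epsilon>0 and t :: "'n \<Rightarrow> real ^ 'd"
    where \<epsilon>0: "\<epsilon>0 > 0" and det_ge: "AE x in \<nu>. \<epsilon>0 \<le> norm (tiling_det G X t x)"
    using assms(2) by blast
  \<comment> \<open>The summand \<open>1\<close> keeps the divisor below positive when every \<open>t\<^sub>k\<close> vanishes.\<close>
  define T where "T = 1 + (\<Sum>l\<in>UNIV. norm (t l))"
  have T: "norm (t l) \<le> T" for l
    unfolding T_def using member_le_sum[of l UNIV "\<lambda>l. norm (t l)"] by simp
  have "T > 0"
    unfolding T_def by (simp add: add_pos_nonneg sum_nonneg)
  define C where "C = fact CARD('n) * (2 * pi * T)"
  have "C > 0"
    unfolding C_def using \<open>T > 0\<close> by simp
  have "\<epsilon>0 / C \<le> norm (shift G (X j) x - shift G (X k) x)"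
    if "\<epsilon>0 \<le> norm (tiling_det G X t x)" "j \<noteq> k" for x j k
    using norm_tiling_det_le[where t = t, OF \<open>j \<noteq> k\<close> T, where G = G and X = X and x = x] that \<open>C > 0\<close>
    by (simp add: C_def pos_divide_le_eq mult_ac)
  then have "ereal (\<epsilon>0 / C) \<le> min_separation G X x"
    if "\<epsilon>0 \<le> norm (tiling_det G X t x)" for x
    unfolding min_separation_def using that by (auto intro!: INF_greatest)
  then have "AE x in \<nu>. ereal (\<epsilon>0 / C) \<le> min_separation G X x"
    using det_ge by (auto elim: eventually_mono)
  then show ?thesis
    using \<epsilon>0 \<open>C > 0\<close> by (intro exI[of _ "\<epsilon>0 / C"]) simp
qed

end
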